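(* Let $p$ be an odd prime. Then $$\left(\frac{2}{p}\right)=(-1)^{\frac{p^{2}-1}{8}},$$ where $\left(\frac{\cdot}{p}\right)$ denotes the Legendre symbol modulo $p$.
   Context: For an odd prime $p$ and an integer $a$, the Legendre symbol $\left(\frac{a}{p}\right)$ is $0$ if $a\equiv 0\pmod p$; otherwise it is $1$ if the congruence $x^{2}\equiv a\pmod p$ has an integer solution $x$, and $-1$ if it has none. *)

theory Defs
  imports "HOL-Number_Theory.Number_Theory"
begin

(* The truncating operations in the exponent (p^2 - 1) div 8 are exact for odd p. *)
lemma eight_dvd_odd_square_minus_one:
  fixes p :: nat
  assumes "odd p"
  shows "8 dvd p\<^sup>2 - 1"
proof -
  from assms obtain k where k: "p = 2 * k + 1" by (rule oddE)
  have "p\<^sup>2 - 1 = 4 * (k * (k + 1))"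
    by (simp add: k power2_eq_square algebra_simps)
  moreover have "even (k * (k + 1))" by simp
  then obtain m where "k * (k + 1) = 2 * m" by (rule evenE)
  ultimately have "p\<^sup>2 - 1 = 8 * m" by simp
  then show ?thesis by simp
qed

end

theory Submission
  imports Defs
begin

text \<open>
  By Gauss's lemma, the Legendre symbol of 2 is \<open>(-1) ^ n\<close>, where \<open>n\<close> counts those multiples
  \<open>2, 4, \<dots>, p - 1\<close> whose residue modulo \<open>p\<close> exceeds \<open>m = (p - 1) / 2\<close>. These multiples are all
  smaller than \<open>p\<close>, so no reduction takes place, and \<open>2 * j\<close> exceeds \<open>m\<close> exactly for the \<open>j\<close>
  with \<open>m div 2 < j \<le> m\<close>. Hence \<open>n = m - m div 2\<close>. On the other hand,
  \<open>(p\<^sup>2 - 1) / 8 = m * (m + 1) / 2\<close> is the triangular number of \<open>m\<close>, which has the same parity: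
  both are odd exactly when \<open>m\<close> is 1 or 2 modulo 4.
\<close>

text \<open>
  Doubling sends \<open>{1..m}\<close> into \<open>{1..<p}\<close>, so the residues in Gauss's lemma are the doubles
  themselves and only the interval of admissible factors has to be counted.
\<close>

lemma (in GAUSS) card_E_two:
  assumes "a = 2"
  shows "card E = (p - 1) div 2 - (p - 1) div 2 div 2"
proof -
  define m where "m = (p - 1) div 2"
  have p: "int p = 2 * int m + 1"
    using odd_p by (auto simp: m_def elim!: oddE)
  have "C = (\<lambda>x. 2 * x) ` A"
    unfolding C_def B_def image_image
    by (rule image_cong) (auto simp: A_def p assms)
  then have "E = (\<lambda>x. 2 * x) ` {int m div 2 <.. int m}"
    unfolding E_def by (auto simp: A_def p)
  then have "card E = card {int m div 2 <.. int m}"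
    by (simp add: card_image inj_on_def)
  then show ?thesis
    unfolding m_def [symmetric] by (simp add: nat_diff_distrib nat_div_distrib)
qed

text \<open>
  For \<open>m = 2 * k\<close> the two numbers are \<open>k * (2 * k + 1)\<close> and \<open>k\<close>, and for \<open>m = 2 * k + 1\<close> they are
  \<open>(2 * k + 1) * (k + 1)\<close> and \<open>k + 1\<close>: in each case they differ by an odd factor.
\<close>

lemma even_triangular_number_iff:
  fixes m :: nat
  shows "even (m * (m + 1) div 2) \<longleftrightarrow> even (m - m div 2)"
proof (cases "even m")
  case True
  then obtain k where "m = 2 * k" by (rule evenE)
  then show ?thesis by simp
next
  case False
  then obtain k where m: "m = 2 * k + 1" by (rule oddE)
  then have "m * (m + 1) = 2 * ((2 * k + 1) * (k + 1))"
    by (simp add: algebra_simps)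
  then have "m * (m + 1) div 2 = (2 * k + 1) * (k + 1)"
    by simp
  moreover have "m - m div 2 = k + 1"
    using m by simp
  ultimately show ?thesis by simp
qed

theorem theorem2:
  fixes p :: nat
  assumes "prime p" and "odd p"
  shows "Legendre 2 (int p) = (-1) ^ ((p\<^sup>2 - 1) div 8)"
proof -
  define m where "m = (p - 1) div 2"
  have p: "p = 2 * m + 1"
    using assms(2) by (auto simp: m_def elim!: oddE)
  have "p > 2"
    using assms prime_ge_2_nat [of p] by (cases "p = 2") auto
  then have "[2 \<noteq> 0] (mod int p)"
    by (simp add: cong_def)
  then interpret GAUSS p 2
    using assms(1) \<open>p > 2\<close> by unfold_locales auto
  have "p\<^sup>2 - 1 = 4 * (m * (m + 1))"
    by (simp add: p power2_eq_square algebra_simps)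
  then have "(p\<^sup>2 - 1) div 8 = m * (m + 1) div 2"
    by simp
  moreover have "Legendre 2 (int p) = (-1) ^ (m - m div 2)"
    using gauss_lemma card_E_two by (simp add: m_def)
  ultimately show ?thesis
    using even_triangular_number_iff [of m] by (simp add: uminus_power_if)
qed

end
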